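(* Let $R$ be a commutative ring with $1\neq 0$ and let $\tau$ be a symmetric relation on $R^{\#}$. Then the following hold. (1) If $R$ is a $\tau$-$r$-UFR, then $R$ is a $\tau$-$r$-HFR. (2) If $\tau$ is refinable and $R$ is a $\tau$-$r$-HFR, then $R$ is a $\tau$-$r$-BFR. (3) If $\tau$ is refinable and $R$ is a $\tau$-$r$-UFR, then $R$ is a $\tau$-$r$-FFR. (4) If $R$ is a $\tau$-$r$-FFR, then $R$ is a $\tau$-$r$-BFR. (5) If $\tau$ is refinable and $R$ is a $\tau$-$r$-BFR, then $R$ satisfies $\tau$-$r$-ACCP. (6) If $\tau$ is refinable and $R$ satisfies $\tau$-$r$-ACCP, then $R$ is $\tau$-$r$-atomic.
   Context: $U(R)$ is the group of units of $R$, $R^{\#}$ the set of nonzero non-units, $\mathrm{Reg}(R)$ the set of regular elements (non-zero-divisors), and $\mathrm{Reg}(R)^{\#}$ the set of regular non-units. Elements $a,b$ are associates, $a\sim b$, if $(a)=(b)$. A $\tau$-factorization of a non-unit $a\in R$ is an expression $a=\lambda a_1\cdots a_n$ with $n\ge 1$, $\lambda\in U(R)$, each $a_i$ a non-unit, and $a_i\,\tau\,a_j$ for all $i\neq j$; it is trivial if $n=1$. The $a_i$ are the $\tau$-factors, or $\tau$-divisors. A $\tau$-$r$-factorization is a $\tau$-factorization of an element $a\in\mathrm{Reg}(R)$. A $\tau$-refinement of a $\tau$-factorization $\lambda a_1\cdots a_n$ is a factorization of the form $(\lambda\lambda_1\cdots\lambda_n)b_{11}\cdots b_{1m_1}\cdots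 b_{n1}\cdots b_{nm_n}$ where $a_i=\lambda_i b_{i1}\cdots b_{im_i}$ is a $\tau$-factorization for each $i$; $\tau$ is refinable if every $\tau$-refinement of a $\tau$-factorization is a $\tau$-factorization. A regular non-unit $a$ is $\tau$-$r$-irreducible (a $\tau$-$r$-atom) if for every $\tau$-$r$-factorization $a=\lambda a_1\cdots a_n$ one has $a\sim a_i$ for some $i$ (equivalently, $a$ has only trivial $\tau$-$r$-factorizations). A $\tau$-$r$-atomic factorization is a $\tau$-$r$-factorization whose factors are all $\tau$-$r$-irreducible. $R$ is $\tau$-$r$-atomic if every $a\in\mathrm{Reg}(R)^{\#}$ has a $\tau$-$r$-atomic factorization. $R$ satisfies $\tau$-$r$-ACCP if there is no infinite properly ascending chain of principal ideals $(a_1)\subsetneq(a_2)\subsetneq\cdots$ generated by regular elements with $a_{i+1}$ occurring as a $\tau$-divisor in some $\tau$-$r$-factorization of $a_i$ for all $i$. $R$ is a $\tau$-$r$-HFR if $R$ is $\tau$-$r$-atomic and whenever $\lambda a_1\cdots a_m=\mu b_1\cdots b_n$ are two $\tau$-$r$-atomic factorizations of the same element, $m=n$. $R$ is a $\tau$-$r$-UFR if $R$ is a $\tau$-$r$-HFR and, for any two such factorizations, there is a rearrangement with $a_i\sim b_i$ for all $i$. $R$ is a $\tau$-$r$-BFR if for every $a\in\mathrm{Reg}(R)$ there is a natural number $N_r(a)$ such that every $\tau$-$r$-factorization $a=\lambda a_1\cdots a_n$ has $n\le N_r(a)$. $R$ is a $\tau$-$r$-FFR if every $a\in\mathrm{Reg}(R)^{\#}$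 has only finitely many $\tau$-factorizations up to order and associates. *)

theory Defs
  imports "HOL-Library.Multiset"
begin

text \<open>The unit group is the set of divisors of \<open>1\<close>. The class \<^class>\<open>comm_ring_1\<close> includes $1 \neq 0$.\<close>

definition units :: "'a::comm_ring_1 set" where
  "units = {u. u dvd 1}"

definition sharp :: "'a::comm_ring_1 set" where
  "sharp = {x. x \<noteq> 0 \<and> x \<notin> units}"

definition Reg :: "'a::comm_ring_1 set" where
  "Reg = {x. \<forall>y. x * y = 0 \<longrightarrow> y = 0}"

definition Reg_sharp :: "'a::comm_ring_1 set" where
  "Reg_sharp = {x \<in> Reg. x \<notin> units}"

definition pideal :: "'a::comm_ring_1 \<Rightarrow> 'a set" where
  "pideal a = {r * a |r. True}"

definition assoc :: "'a::comm_ring_1 \<Rightarrow> 'a \<Rightarrow> bool" where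
  "assoc a b \<longleftrightarrow> pideal a = pideal b"

text \<open>An expression $\lambda a_1 \cdots a_n$ is the pair of $\lambda$ and the list of the $a_i$.
  The element $a$ may be $0$; as $\tau$ only relates nonzero non-units, $0$ can then
  occur as a factor only if $n = 1$.\<close>

definition tau_fact :: "('a::comm_ring_1 \<times> 'a) set \<Rightarrow> 'a \<Rightarrow> 'a \<times> 'a list \<Rightarrow> bool" where
  "tau_fact \<tau> a f \<longleftrightarrow>
     a \<notin> units \<and> a = fst f * prod_list (snd f) \<and> 1 \<le> length (snd f) \<and> fst f \<in> units \<and>
     (\<forall>i<length (snd f). snd f ! i \<notin> units) \<and>
     (\<forall>i<length (snd f). \<forall>j<length (snd f). i \<noteq> j \<longrightarrow> (snd f ! i, snd f ! j) \<in> \<tau>)"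

definition tau_r_fact :: "('a::comm_ring_1 \<times> 'a) set \<Rightarrow> 'a \<Rightarrow> 'a \<times> 'a list \<Rightarrow> bool" where
  "tau_r_fact \<tau> a f \<longleftrightarrow> a \<in> Reg \<and> tau_fact \<tau> a f"

text \<open>The \<open>i\<close>-th entry of \<open>gs\<close> is the factorization $\lambda_i b_{i1} \cdots b_{im_i}$
  of the \<open>i\<close>-th factor of \<open>f\<close>.\<close>

definition tau_refinement ::
    "('a::comm_ring_1 \<times> 'a) set \<Rightarrow> 'a \<times> 'a list \<Rightarrow> 'a \<times> 'a list \<Rightarrow> bool" where
  "tau_refinement \<tau> f f' \<longleftrightarrow>
     (\<exists>gs. length gs = length (snd f) \<and>
        (\<forall>i<length gs. tau_fact \<tau> (snd f ! i) (gs ! i)) \<and>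
        f' = (fst f * prod_list (map fst gs), concat (map snd gs)))"

definition refinable :: "('a::comm_ring_1 \<times> 'a) set \<Rightarrow> bool" where
  "refinable \<tau> \<longleftrightarrow>
     (\<forall>a f f'. tau_fact \<tau> a f \<longrightarrow> tau_refinement \<tau> f f' \<longrightarrow> tau_fact \<tau> a f')"

definition tau_r_irreducible :: "('a::comm_ring_1 \<times> 'a) set \<Rightarrow> 'a \<Rightarrow> bool" where
  "tau_r_irreducible \<tau> a \<longleftrightarrow>
     a \<in> Reg_sharp \<and> (\<forall>f. tau_r_fact \<tau> a f \<longrightarrow> (\<exists>b\<in>set (snd f). assoc a b))"

definition tau_r_atomic_fact :: "('a::comm_ring_1 \<times> 'a) set \<Rightarrow> 'a \<Rightarrow> 'a \<times> 'a list \<Rightarrow> bool" where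
  "tau_r_atomic_fact \<tau> a f \<longleftrightarrow>
     tau_r_fact \<tau> a f \<and> (\<forall>b\<in>set (snd f). tau_r_irreducible \<tau> b)"

text \<open>Equality of factorizations up to order and associates; the unit factors are
  disregarded, since they change when factors are replaced by associates.\<close>

definition same_fact :: "'a::comm_ring_1 \<times> 'a list \<Rightarrow> 'a \<times> 'a list \<Rightarrow> bool" where
  "same_fact f g \<longleftrightarrow> (\<exists>bs. mset bs = mset (snd g) \<and> list_all2 assoc (snd f) bs)"

definition tau_r_atomic :: "('a::comm_ring_1 \<times> 'a) set \<Rightarrow> bool" where
  "tau_r_atomic \<tau> \<longleftrightarrow> (\<forall>a\<in>Reg_sharp. \<exists>f. tau_r_atomic_fact \<tau> a f)"

definition tau_r_ACCP :: "('a::comm_ring_1 \<times> 'a) set \<Rightarrow> bool" where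
  "tau_r_ACCP \<tau> \<longleftrightarrow>
     \<not> (\<exists>a :: nat \<Rightarrow> 'a. \<forall>i. a i \<in> Reg \<and> pideal (a i) \<subset> pideal (a (Suc i)) \<and>
          (\<exists>f. tau_r_fact \<tau> (a i) f \<and> a (Suc i) \<in> set (snd f)))"

definition tau_r_HFR :: "('a::comm_ring_1 \<times> 'a) set \<Rightarrow> bool" where
  "tau_r_HFR \<tau> \<longleftrightarrow> tau_r_atomic \<tau> \<and>
     (\<forall>a f g. tau_r_atomic_fact \<tau> a f \<longrightarrow> tau_r_atomic_fact \<tau> a g \<longrightarrow>
        length (snd f) = length (snd g))"

definition tau_r_UFR :: "('a::comm_ring_1 \<times> 'a) set \<Rightarrow> bool" where
  "tau_r_UFR \<tau> \<longleftrightarrow> tau_r_HFR \<tau> \<and>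
     (\<forall>a f g. tau_r_atomic_fact \<tau> a f \<longrightarrow> tau_r_atomic_fact \<tau> a g \<longrightarrow> same_fact f g)"

definition tau_r_BFR :: "('a::comm_ring_1 \<times> 'a) set \<Rightarrow> bool" where
  "tau_r_BFR \<tau> \<longleftrightarrow>
     (\<forall>a\<in>Reg. \<exists>N::nat. \<forall>f. tau_r_fact \<tau> a f \<longrightarrow> length (snd f) \<le> N)"

definition tau_r_FFR :: "('a::comm_ring_1 \<times> 'a) set \<Rightarrow> bool" where
  "tau_r_FFR \<tau> \<longleftrightarrow>
     (\<forall>a\<in>Reg_sharp. finite ({f. tau_fact \<tau> a f} // {(f, g). same_fact f g}))"

text \<open>The quotient in \<open>tau_r_FFR\<close> is by an equivalence relation.\<close>

lemma list_all2_mset_swap: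
  assumes "list_all2 P xs ys" "mset xs' = mset xs"
  shows "\<exists>ys'. mset ys' = mset ys \<and> list_all2 P xs' ys'"
  using list_all2_reorder_left_invariance[OF assms] by blast

lemma equiv_same_fact: "equiv UNIV {(f, g). same_fact f g}"
proof (rule equivI)
  have sy: "list_all2 assoc ys xs" if "list_all2 assoc xs ys" for xs ys :: "'a list"
    using that by (auto simp: list_all2_conv_all_nth assoc_def)
  have tr: "list_all2 assoc xs zs" if "list_all2 assoc xs ys" "list_all2 assoc ys zs"
    for xs ys zs :: "'a list"
    using that by (auto simp: list_all2_conv_all_nth assoc_def)
  show "refl {(f :: 'a \<times> 'a list, g). same_fact f g}"
    by (auto simp: refl_on_def same_fact_def assoc_def intro!: exI list_all2_refl)
  show "sym {(f :: 'a \<times> 'a list, g). same_fact f g}"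
  proof (rule symI, clarsimp simp: same_fact_def)
    fix as bs cs :: "'a list"
    assume "mset bs = mset cs" "list_all2 assoc as bs"
    then show "\<exists>ds. mset ds = mset as \<and> list_all2 assoc cs ds"
      using list_all2_mset_swap sy by metis
  qed
  show "trans {(f :: 'a \<times> 'a list, g). same_fact f g}"
  proof (rule transI, clarsimp simp: same_fact_def)
    fix as bs cs bs' cs' :: "'a list"
    assume "mset bs' = mset bs" "list_all2 assoc as bs'" "mset cs' = mset cs" "list_all2 assoc bs cs'"
    then show "\<exists>ds. mset ds = mset cs \<and> list_all2 assoc as ds"
      using list_all2_mset_swap tr by metis
  qed
qed simp

end

theory Submission
  imports Defs
begin

text \<open>The implications for refinable \<open>\<tau>\<close> all rest on one construction:
  choosing a \<open>\<tau>\<close>-factorization of each factor of a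
  \<open>\<tau>\<close>-factorization of \<open>a\<close> and substituting gives another \<open>\<tau>\<close>-factorization of \<open>a\<close> (\<open>tau_fact_refine_by\<close>), at least as long as
  the original one (\<open>length_refine_by\<close>). Factors of a regular element are regular, so
  conditions on regular non-units apply to the factors as well.

  If \<open>R\<close> is \<open>\<tau>\<close>-\<open>r\<close>-atomic, any \<open>\<tau>\<close>-factorization of a regular element \<open>a\<close> therefore refines
  to an atomic one. In a half-factorial ring, the common length of the atomic factorizations of
  \<open>a\<close> thus bounds the length of all its \<open>\<tau>\<close>-factorizations. If the atomic factorization is even
  unique, every factor of every \<open>\<tau>\<close>-factorization generates the same principal ideal as the
  product of some submultiset of the atoms of \<open>a\<close>. There are finitely many such ideals, hence
  finitely many lists of bounded length with entries among them, and this is finite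
  factorization. Finite factorization, for any \<open>\<tau>\<close>, bounds lengths because
  equality up to order and associates preserves the length.

  In a properly ascending divisor chain, each element has a \<open>\<tau>\<close>-factorization with at
  least two factors containing the next element; repeated substitution makes the
  \<open>\<tau>\<close>-factorizations of the first element arbitrarily long, against bounded factorization.
  Finally, a regular non-unit without atomic factorization is no atom, so it has a
  \<open>\<tau>\<close>-factorization into non-associates, and one of the factors again has no atomic
  factorization, since otherwise substitution would give one. Iterating yields an infinite
  properly ascending chain.\<close>

section \<open>Principal ideals, regular elements and factors\<close>

lemma pideal_subset_iff_dvd: "pideal a \<subseteq> pideal b \<longleftrightarrow> b dvd a"
proof
  assume "pideal a \<subseteq> pideal b"
  moreover have "a \<in> pideal a" by (auto simp: pideal_def intro: exI[of _ 1])
  ultimately show "b dvd a" by (auto simp: pideal_def)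
next
  assume "b dvd a"
  then obtain c where "a = b * c" ..
  then have "r * a = (r * c) * b" for r by (simp add: ac_simps)
  then show "pideal a \<subseteq> pideal b" by (auto simp: pideal_def)
qed

lemma pideal_eq_iff_dvd: "pideal a = pideal b \<longleftrightarrow> b dvd a \<and> a dvd b"
  using pideal_subset_iff_dvd[of a b] pideal_subset_iff_dvd[of b a] by blast

lemma pideal_unit_mult:
  assumes "u \<in> units"
  shows "pideal (u * a) = pideal a"
proof -
  have "u * a dvd 1 * a" using assms by (intro mult_dvd_mono) (auto simp: units_def)
  then show ?thesis by (simp add: pideal_eq_iff_dvd)
qed

lemma pideal_mult_cong:
  assumes "pideal a = pideal b" "pideal c = pideal d"
  shows "pideal (a * c) = pideal (b * d)"
  using assms unfolding pideal_eq_iff_dvd by (blast intro: mult_dvd_mono)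

lemma Reg_dvd:
  assumes "a \<in> Reg" "b dvd a"
  shows "b \<in> Reg"
proof -
  obtain c where a: "a = b * c" using assms(2) ..
  have "y = 0" if "b * y = 0" for y
  proof -
    have "a * y = c * (b * y)" by (simp add: a ac_simps)
    with that have "a * y = 0" by simp
    with assms(1) show "y = 0" by (simp add: Reg_def)
  qed
  then show ?thesis by (simp add: Reg_def)
qed

lemma prod_list_dvd:
  fixes x :: "'a::comm_monoid_mult"
  shows "x \<in> set xs \<Longrightarrow> x dvd prod_list xs"
  by (induction xs) auto

lemma tau_fact_factor_dvd:
  assumes "tau_fact \<tau> a f" "b \<in> set (snd f)"
  shows "b dvd a"
  using assms prod_list_dvd[of b "snd f"] unfolding tau_fact_def by (metis dvd_mult)

lemma tau_fact_factor_nonunit: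
  assumes "tau_fact \<tau> a f" "b \<in> set (snd f)"
  shows "b \<notin> units"
  using assms by (auto simp: tau_fact_def in_set_conv_nth)

lemma tau_r_fact_factor_Reg_sharp:
  assumes "tau_r_fact \<tau> a f" "b \<in> set (snd f)"
  shows "b \<in> Reg_sharp"
  using assms Reg_dvd[OF _ tau_fact_factor_dvd] tau_fact_factor_nonunit
  unfolding tau_r_fact_def Reg_sharp_def by blast

lemma tau_fact_trivial:
  assumes "a \<notin> units"
  shows "tau_fact \<tau> a (1, [a])"
  using assms by (simp add: tau_fact_def units_def)

section \<open>Refining all factors at once\<close>

text \<open>Refinement along a choice of one factorization for each ring element. Indexing
  the choice by elements instead of positions refines equal factors alike and makes the
  refinement a function of the factorization.\<close>

definition refine_by :: "('a::comm_ring_1 \<Rightarrow> 'a \<times> 'a list) \<Rightarrow> 'a \<times> 'a list \<Rightarrow> 'a \<times> 'a list" where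
  "refine_by G f =
     (fst f * prod_list (map (fst \<circ> G) (snd f)), concat (map (snd \<circ> G) (snd f)))"

lemma set_refine_by: "set (snd (refine_by G f)) = (\<Union>b\<in>set (snd f). set (snd (G b)))"
  by (auto simp: refine_by_def)

lemma tau_fact_refine_by:
  assumes "refinable \<tau>" "tau_fact \<tau> a f" "\<And>b. b \<in> set (snd f) \<Longrightarrow> tau_fact \<tau> b (G b)"
  shows "tau_fact \<tau> a (refine_by G f)"
proof -
  have "tau_refinement \<tau> f (refine_by G f)"
    unfolding tau_refinement_def
    by (rule exI[of _ "map G (snd f)"]) (simp add: refine_by_def assms(3))
  with assms(1,2) show ?thesis unfolding refinable_def by blast
qed

lemma tau_r_fact_refine_by:
  assumes "refinable \<tau>" "tau_r_fact \<tau> a f" "\<And>b. b \<in> set (snd f) \<Longrightarrow> tau_fact \<tau> b (G b)"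
  shows "tau_r_fact \<tau> a (refine_by G f)"
  using assms(2) tau_fact_refine_by[OF assms(1) _ assms(3)] by (simp add: tau_r_fact_def)

lemma length_le_length_concat:
  assumes "\<And>x. x \<in> set xs \<Longrightarrow> 1 \<le> length (h x)"
  shows "length xs \<le> length (concat (map h xs))"
  using assms
proof (induction xs)
  case (Cons y ys)
  have "length ys \<le> length (concat (map h ys))" using Cons by simp
  moreover have "1 \<le> length (h y)" using Cons.prems by simp
  ultimately show ?case by simp
qed simp

lemma length_less_length_concat:
  assumes "\<And>x. x \<in> set xs \<Longrightarrow> 1 \<le> length (h x)" "y \<in> set xs" "2 \<le> length (h y)"
  shows "length xs < length (concat (map h xs))"
proof -
  obtain us vs where xs: "xs = us @ y # vs" using assms(2) by (meson split_list)
  have "length us \<le> length (concat (map h us))" "length vs \<le> length (concat (map h vs))"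
    using assms(1) by (auto intro!: length_le_length_concat simp: xs)
  with assms(3) show ?thesis by (simp add: xs)
qed

lemma length_refine_by:
  assumes "\<And>b. b \<in> set (snd f) \<Longrightarrow> tau_fact \<tau> b (G b)"
  shows "length (snd f) \<le> length (snd (refine_by G f))"
  using assms length_le_length_concat[of "snd f" "snd \<circ> G"]
  by (simp add: refine_by_def tau_fact_def)

lemma length_refine_by_strict:
  assumes "\<And>b. b \<in> set (snd f) \<Longrightarrow> tau_fact \<tau> b (G b)"
    and "c \<in> set (snd f)" "2 \<le> length (snd (G c))"
  shows "length (snd f) < length (snd (refine_by G f))"
  using assms length_less_length_concat[of "snd f" "snd \<circ> G" c]
  by (simp add: refine_by_def tau_fact_def)

lemma tau_r_atomic_fact_refine_by:
  assumes "refinable \<tau>" "tau_r_fact \<tau> a f"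
    and "\<And>b. b \<in> set (snd f) \<Longrightarrow> tau_r_atomic_fact \<tau> b (G b)"
  shows "tau_r_atomic_fact \<tau> a (refine_by G f)"
  using assms tau_r_fact_refine_by[OF assms(1,2), of G]
  by (auto simp: tau_r_atomic_fact_def set_refine_by tau_r_fact_def)

lemma tau_r_atomic_choice:
  assumes "tau_r_atomic \<tau>"
  shows "\<exists>G. \<forall>b\<in>Reg_sharp. tau_r_atomic_fact \<tau> b (G b)"
  using assms unfolding tau_r_atomic_def by (rule bchoice)

section \<open>Bounded factorization in half-factorial rings\<close>

text \<open>A unit has no \<open>\<tau>\<close>-factorization at all, so lengths need to be bounded for regular
  non-units only.\<close>

lemma tau_r_BFR_I:
  assumes "\<And>a. a \<in> Reg_sharp \<Longrightarrow> \<exists>N. \<forall>f. tau_r_fact \<tau> a f \<longrightarrow> length (snd f) \<le> N"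
  shows "tau_r_BFR \<tau>"
  unfolding tau_r_BFR_def
proof
  fix a :: 'a assume "a \<in> Reg"
  show "\<exists>N. \<forall>f. tau_r_fact \<tau> a f \<longrightarrow> length (snd f) \<le> N"
  proof (cases "a \<in> units")
    case True
    then have "\<not> tau_r_fact \<tau> a f" for f unfolding tau_r_fact_def tau_fact_def by blast
    then show ?thesis by blast
  next
    case False
    with \<open>a \<in> Reg\<close> have "a \<in> Reg_sharp" by (simp add: Reg_sharp_def)
    then show ?thesis by (rule assms)
  qed
qed

text \<open>Any \<open>\<tau>\<close>-factorization refines to an atomic one, whose length does not depend on the
  factorization that one started from.\<close>

lemma refinable_HFR_imp_BFR:
  assumes "refinable \<tau>" "tau_r_HFR \<tau>"
  shows "tau_r_BFR \<tau>"
proof (rule tau_r_BFR_I)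
  fix a :: 'a assume a: "a \<in> Reg_sharp"
  have "tau_r_atomic \<tau>" using assms(2) by (simp add: tau_r_HFR_def)
  then obtain G where G: "\<And>b. b \<in> Reg_sharp \<Longrightarrow> tau_r_atomic_fact \<tau> b (G b)"
    using tau_r_atomic_choice by blast
  have "length (snd f) \<le> length (snd (G a))" if f: "tau_r_fact \<tau> a f" for f
  proof -
    have Gb: "tau_r_atomic_fact \<tau> b (G b)" if "b \<in> set (snd f)" for b
      using G tau_r_fact_factor_Reg_sharp[OF f that] .
    have atomic: "tau_r_atomic_fact \<tau> a (refine_by G f)"
      using assms(1) f Gb by (rule tau_r_atomic_fact_refine_by)
    have "length (snd f) \<le> length (snd (refine_by G f))"
      using Gb by (intro length_refine_by) (auto simp: tau_r_atomic_fact_def tau_r_fact_def)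
    also have "\<dots> = length (snd (G a))"
      using atomic G[OF a] assms(2) unfolding tau_r_HFR_def by blast
    finally show ?thesis .
  qed
  then show "\<exists>N. \<forall>f. tau_r_fact \<tau> a f \<longrightarrow> length (snd f) \<le> N"
    by (intro exI[of _ "length (snd (G a))"] allI impI)
qed

section \<open>Finite factorization in unique factorization rings\<close>

text \<open>The principal ideal of a product depends only on the principal ideals of the factors:
  each factor can be replaced by a generator \<open>rep\<close> chosen for its ideal. So the ideals of
  partial products are controlled by the finitely many submultisets of a multiset of ideals.\<close>

lemma pideal_prod_mset_representatives:
  assumes "\<And>x. pideal (rep (pideal x)) = pideal x"
  shows "pideal (prod_mset (image_mset rep (image_mset pideal B))) = pideal (prod_mset B)"
proof (induction B)
  case (add x B)
  have "pideal (rep (pideal x) * prod_mset (image_mset rep (image_mset pideal B)))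
      = pideal (x * prod_mset B)"
    using assms add.IH by (rule pideal_mult_cong)
  then show ?case by (simp only: image_mset_add_mset prod_mset.add_mset)
qed (simp only: image_mset_empty prod_mset_empty)

lemma finite_submultisets: "finite {C. C \<subseteq># M}"
proof (rule finite_subset)
  show "{C. C \<subseteq># M} \<subseteq> mset ` {xs. set xs \<subseteq> set_mset M \<and> length xs \<le> size M}"
  proof
    fix C assume "C \<in> {C. C \<subseteq># M}"
    moreover obtain xs where "C = mset xs" by (metis ex_mset)
    ultimately show "C \<in> mset ` {xs. set xs \<subseteq> set_mset M \<and> length xs \<le> size M}"
      using set_mset_mono[of C M] size_mset_mono[of C M] by auto
  qed
  show "finite (mset ` {xs. set xs \<subseteq> set_mset M \<and> length xs \<le> size M})"
    by (intro finite_imageI finite_lists_length_le) simp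
qed

lemma finite_pideals_of_subproducts:
  "finite {pideal (prod_mset B) |B. image_mset pideal B \<subseteq># M}"
proof -
  define rep :: "'a set \<Rightarrow> 'a" where "rep I = (SOME x. pideal x = I)" for I
  have "pideal (rep (pideal x)) = pideal x" for x
    unfolding rep_def by (rule someI[of _ x]) simp
  then have "pideal (prod_mset B) = pideal (prod_mset (image_mset rep (image_mset pideal B)))" for B
    by (simp only: pideal_prod_mset_representatives)
  then have "{pideal (prod_mset B) |B. image_mset pideal B \<subseteq># M}
      \<subseteq> (\<lambda>C. pideal (prod_mset (image_mset rep C))) ` {C. C \<subseteq># M}"
    by blast
  moreover have "finite {C. C \<subseteq># M}" by (rule finite_submultisets)
  ultimately show ?thesis by (meson finite_imageI finite_subset)
qed

lemma same_fact_imp_image_mset_eq: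
  assumes "same_fact f g"
  shows "image_mset pideal (mset (snd f)) = image_mset pideal (mset (snd g))"
proof -
  obtain bs where bs: "mset bs = mset (snd g)" "list_all2 assoc (snd f) bs"
    using assms unfolding same_fact_def by blast
  have "map pideal (snd f) = map pideal bs"
    using bs(2) by (auto simp: list_all2_conv_all_nth assoc_def intro: nth_equalityI)
  then have "image_mset pideal (mset (snd f)) = image_mset pideal (mset bs)"
    by (metis mset_map)
  with bs(1) show ?thesis by simp
qed

lemma same_factI_map_pideal:
  assumes "map pideal (snd f) = map pideal (snd g)"
  shows "same_fact f g"
proof -
  have "list_all2 assoc (snd f) (snd g)"
    using assms unfolding list_all2_conv_all_nth assoc_def
    by (metis length_map nth_map)
  then show ?thesis by (auto simp: same_fact_def)
qed

lemma mset_subseteq_concat: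
  "x \<in> set xs \<Longrightarrow> mset (h x) \<subseteq># mset (concat (map h xs))"
  by (induction xs) (auto intro: subset_mset.add_increasing)

lemma finite_quotient_if_finite_image:
  assumes "finite (h ` A)" "equiv UNIV r" "\<And>x y. h x = h y \<Longrightarrow> (x, y) \<in> r"
  shows "finite (A // r)"
proof -
  have "r `` {x} = r `` {inv_into A h (h x)}" if "x \<in> A" for x
    using that assms(2,3) by (metis equiv_class_eq f_inv_into_f imageI)
  then have "A // r \<subseteq> (\<lambda>y. r `` {inv_into A h y}) ` h ` A"
    by (auto simp: quotient_def)
  with assms(1) show ?thesis by (meson finite_imageI finite_subset)
qed

text \<open>A factor \<open>b\<close> of a \<open>\<tau>\<close>-factorization of \<open>a\<close> is, up to a unit, a product of part of the
  atoms in the refined factorization. By uniqueness these atoms are, up to associates, those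
  of one fixed atomic factorization of \<open>a\<close>, which leaves finitely many ideals for \<open>b\<close>. The number
  of factors is bounded because unique factorization implies bounded factorization.\<close>

lemma refinable_UFR_imp_FFR:
  fixes \<tau> :: "('a::comm_ring_1 \<times> 'a) set"
  assumes "refinable \<tau>" "tau_r_UFR \<tau>"
  shows "tau_r_FFR \<tau>"
  unfolding tau_r_FFR_def
proof
  fix a :: 'a assume a: "a \<in> Reg_sharp"
  then have a_Reg: "a \<in> Reg" by (simp add: Reg_sharp_def)
  have HFR: "tau_r_HFR \<tau>" using assms(2) by (simp add: tau_r_UFR_def)
  have "tau_r_atomic \<tau>" using HFR by (simp add: tau_r_HFR_def)
  then obtain G where G: "\<And>b. b \<in> Reg_sharp \<Longrightarrow> tau_r_atomic_fact \<tau> b (G b)"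
    using tau_r_atomic_choice by blast
  obtain N where N: "\<And>f. tau_r_fact \<tau> a f \<Longrightarrow> length (snd f) \<le> N"
    using refinable_HFR_imp_BFR[OF assms(1) HFR] a_Reg unfolding tau_r_BFR_def by blast
  define M where "M = image_mset pideal (mset (snd (G a)))"
  define P where "P = {pideal (prod_mset B) |B. image_mset pideal B \<subseteq># M}"
  have "set (map pideal (snd f)) \<subseteq> P \<and> length (map pideal (snd f)) \<le> N"
    if "tau_fact \<tau> a f" for f
  proof -
    have f: "tau_r_fact \<tau> a f" using that a_Reg by (simp add: tau_r_fact_def)
    have Gb: "tau_r_atomic_fact \<tau> b (G b)" if "b \<in> set (snd f)" for b
      using G tau_r_fact_factor_Reg_sharp[OF f that] .
    have "tau_r_atomic_fact \<tau> a (refine_by G f)"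
      using assms(1) f Gb by (rule tau_r_atomic_fact_refine_by)
    then have "same_fact (refine_by G f) (G a)"
      using G[OF a] assms(2) unfolding tau_r_UFR_def by blast
    then have M: "image_mset pideal (mset (snd (refine_by G f))) = M"
      unfolding M_def by (rule same_fact_imp_image_mset_eq)
    have "pideal b \<in> P" if b: "b \<in> set (snd f)" for b
    proof -
      have "mset (snd (G b)) \<subseteq># mset (snd (refine_by G f))"
        using mset_subseteq_concat[OF b, of "snd \<circ> G"] by (simp add: refine_by_def)
      then have "image_mset pideal (mset (snd (G b))) \<subseteq># M"
        unfolding M[symmetric] by (rule image_mset_subseteq_mono)
      moreover have "fst (G b) \<in> units" "b = fst (G b) * prod_list (snd (G b))"
        using Gb[OF b] unfolding tau_r_atomic_fact_def tau_r_fact_def tau_fact_def by blast+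
      then have "pideal b = pideal (prod_mset (mset (snd (G b))))"
        by (metis pideal_unit_mult prod_mset_prod_list)
      ultimately show ?thesis unfolding P_def by blast
    qed
    with N[OF f] show ?thesis by auto
  qed
  then have "(\<lambda>f. map pideal (snd f)) ` {f. tau_fact \<tau> a f}
      \<subseteq> {Is. set Is \<subseteq> P \<and> length Is \<le> N}"
    by blast
  moreover have "finite P" unfolding P_def by (rule finite_pideals_of_subproducts)
  then have "finite {Is. set Is \<subseteq> P \<and> length Is \<le> N}" by (rule finite_lists_length_le)
  ultimately have "finite ((\<lambda>f. map pideal (snd f)) ` {f. tau_fact \<tau> a f})"
    by (rule finite_subset)
  then show "finite ({f. tau_fact \<tau> a f} // {(f, g). same_fact f g})"
    using equiv_same_fact by (rule finite_quotient_if_finite_image) (simp add: same_factI_map_pideal)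
qed

section \<open>Bounded factorization in finite factorization rings\<close>

lemma same_fact_imp_length_eq:
  assumes "same_fact f g"
  shows "length (snd f) = length (snd g)"
  using arg_cong[OF same_fact_imp_image_mset_eq[OF assms], of size] by simp

text \<open>The length of a factorization is constant on classes, so it takes finitely many values
  on finitely many classes.\<close>

lemma FFR_imp_BFR:
  assumes "tau_r_FFR \<tau>"
  shows "tau_r_BFR \<tau>"
proof (rule tau_r_BFR_I)
  fix a :: 'a assume a: "a \<in> Reg_sharp"
  let ?F = "{f. tau_fact \<tau> a f}" and ?r = "{(f :: 'a \<times> 'a list, g). same_fact f g}"
  have "finite (?F // ?r)" using assms a by (simp add: tau_r_FFR_def)
  moreover have "(\<lambda>f. length (snd f)) ` ?F \<subseteq> (\<lambda>X. length (snd (SOME f. f \<in> X))) ` (?F // ?r)"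
  proof
    fix n assume "n \<in> (\<lambda>f. length (snd f)) ` ?F"
    then obtain f where f: "f \<in> ?F" "n = length (snd f)" by blast
    have "f \<in> ?r `` {f}" using equiv_class_self[OF equiv_same_fact] by blast
    then have "(SOME g. g \<in> ?r `` {f}) \<in> ?r `` {f}" by (rule someI)
    then have "same_fact f (SOME g. g \<in> ?r `` {f})" by simp
    then have "n = length (snd (SOME g. g \<in> ?r `` {f}))"
      using f(2) same_fact_imp_length_eq by metis
    then show "n \<in> (\<lambda>X. length (snd (SOME f. f \<in> X))) ` (?F // ?r)"
      using quotientI[OF f(1), of ?r] by (rule image_eqI)
  qed
  ultimately have "finite ((\<lambda>f. length (snd f)) ` ?F)"
    by (rule finite_surj)
  then obtain N where "\<forall>n\<in>(\<lambda>f. length (snd f)) ` ?F. n \<le> N"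
    by (meson finite_nat_set_iff_bounded_le)
  then show "\<exists>N. \<forall>f. tau_r_fact \<tau> a f \<longrightarrow> length (snd f) \<le> N"
    by (auto simp: tau_r_fact_def)
qed

section \<open>Ascending chains and atomicity\<close>

lemma two_le_length_if_proper_factor:
  assumes "tau_fact \<tau> a f" "b \<in> set (snd f)" "pideal a \<noteq> pideal b"
  shows "2 \<le> length (snd f)"
proof (rule ccontr)
  assume "\<not> 2 \<le> length (snd f)"
  with assms(2) have "snd f = [b]" by (cases "snd f" rule: remdups_adj.cases) auto
  then have "a = fst f * b" "fst f \<in> units" using assms(1) by (simp_all add: tau_fact_def)
  with assms(3) show False by (simp add: pideal_unit_mult)
qed

text \<open>Along a properly ascending divisor chain, the last element reached remains a factor of
  a \<open>\<tau>\<close>-factorization of the first one; substituting its nontrivial factorization for it makes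
  that factorization longer at each step.\<close>

lemma refinable_BFR_imp_ACCP:
  fixes \<tau> :: "('a::comm_ring_1 \<times> 'a) set"
  assumes "refinable \<tau>" "tau_r_BFR \<tau>"
  shows "tau_r_ACCP \<tau>"
  unfolding tau_r_ACCP_def
proof
  assume "\<exists>a :: nat \<Rightarrow> 'a. \<forall>i. a i \<in> Reg \<and> pideal (a i) \<subset> pideal (a (Suc i)) \<and>
          (\<exists>f. tau_r_fact \<tau> (a i) f \<and> a (Suc i) \<in> set (snd f))"
  then obtain a :: "nat \<Rightarrow> 'a" and h where
    reg: "\<And>i. a i \<in> Reg" and proper: "\<And>i. pideal (a i) \<subset> pideal (a (Suc i))"
    and h: "\<And>i. tau_r_fact \<tau> (a i) (h i)" and a_in: "\<And>i. a (Suc i) \<in> set (snd (h i))"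
    by metis
  have h': "tau_fact \<tau> (a i) (h i)" for i using h by (simp add: tau_r_fact_def)
  have long: "2 \<le> length (snd (h i))" for i
    using two_le_length_if_proper_factor[OF h' a_in] proper[of i] by blast
  have growth: "\<exists>f. tau_r_fact \<tau> (a 0) f \<and> a n \<in> set (snd f) \<and> n < length (snd f)" for n
  proof (induction n)
    case 0
    have "a 0 \<notin> units" using h'[of 0] unfolding tau_fact_def by blast
    then show ?case
      using reg[of 0] tau_fact_trivial[of "a 0" \<tau>]
      by (intro exI[of _ "(1, [a 0])"]) (simp add: tau_r_fact_def)
  next
    case (Suc n)
    then obtain f where f: "tau_r_fact \<tau> (a 0) f" "a n \<in> set (snd f)" "n < length (snd f)"
      by blast
    define G where "G b = (if b = a n then h n else (1, [b]))" for b
    have G: "tau_fact \<tau> b (G b)" if "b \<in> set (snd f)" for b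
    proof (cases "b = a n")
      case True
      then show ?thesis using h'[of n] by (simp add: G_def)
    next
      case False
      have "b \<notin> units"
        using f(1) that tau_fact_factor_nonunit unfolding tau_r_fact_def by blast
      then have "tau_fact \<tau> b (1, [b])" by (rule tau_fact_trivial)
      with False show ?thesis by (simp add: G_def)
    qed
    have "length (snd f) < length (snd (refine_by G f))"
      using G f(2) by (rule length_refine_by_strict) (simp_all add: G_def long)
    moreover have "a (Suc n) \<in> set (snd (refine_by G f))"
      using f(2) a_in[of n] by (auto simp: set_refine_by G_def intro!: bexI[of _ "a n"])
    ultimately show ?case
      using tau_r_fact_refine_by[OF assms(1) f(1) G] f(3)
      by (intro exI[of _ "refine_by G f"]) auto
  qed
  obtain N where "\<And>f. tau_r_fact \<tau> (a 0) f \<Longrightarrow> length (snd f) \<le> N"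
    using assms(2) reg unfolding tau_r_BFR_def by blast
  with growth[of N] show False by fastforce
qed

text \<open>The property of having no atomic factorization passes from an element to one of
  its proper \<open>\<tau>\<close>-divisors; this is the step of the infinite ascent.\<close>

lemma nonatomic_proper_factor:
  assumes "refinable \<tau>" "a \<in> Reg_sharp" "\<nexists>f. tau_r_atomic_fact \<tau> a f"
  obtains b f where "tau_r_fact \<tau> a f" "b \<in> set (snd f)" "pideal a \<subset> pideal b"
    "b \<in> Reg_sharp" "\<nexists>g. tau_r_atomic_fact \<tau> b g"
proof -
  have "\<not> tau_r_irreducible \<tau> a"
  proof
    assume "tau_r_irreducible \<tau> a"
    moreover have "tau_r_fact \<tau> a (1, [a])"
      using assms(2) tau_fact_trivial by (auto simp: tau_r_fact_def Reg_sharp_def)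
    ultimately have "tau_r_atomic_fact \<tau> a (1, [a])" by (simp add: tau_r_atomic_fact_def)
    with assms(3) show False by blast
  qed
  then obtain f where f: "tau_r_fact \<tau> a f" "\<And>b. b \<in> set (snd f) \<Longrightarrow> pideal a \<noteq> pideal b"
    using assms(2) unfolding tau_r_irreducible_def assoc_def by blast
  have "\<exists>b\<in>set (snd f). \<nexists>g. tau_r_atomic_fact \<tau> b g"
  proof (rule ccontr)
    assume "\<not> ?thesis"
    then have "\<forall>b\<in>set (snd f). \<exists>g. tau_r_atomic_fact \<tau> b g" by blast
    then obtain G where "\<And>b. b \<in> set (snd f) \<Longrightarrow> tau_r_atomic_fact \<tau> b (G b)"
      using bchoice[of "set (snd f)" "tau_r_atomic_fact \<tau>"] by blast
    with assms(1) f(1) have "tau_r_atomic_fact \<tau> a (refine_by G f)"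
      by (rule tau_r_atomic_fact_refine_by)
    with assms(3) show False by blast
  qed
  then obtain b where b: "b \<in> set (snd f)" "\<nexists>g. tau_r_atomic_fact \<tau> b g" by blast
  have "b dvd a" using f(1) b(1) tau_fact_factor_dvd unfolding tau_r_fact_def by blast
  then have "pideal a \<subset> pideal b" using f(2)[OF b(1)] pideal_subset_iff_dvd by blast
  with that f(1) b tau_r_fact_factor_Reg_sharp show thesis by blast
qed

lemma refinable_ACCP_imp_atomic:
  fixes \<tau> :: "('a::comm_ring_1 \<times> 'a) set"
  assumes "refinable \<tau>" "tau_r_ACCP \<tau>"
  shows "tau_r_atomic \<tau>"
proof (rule ccontr)
  define Bad where "Bad x \<longleftrightarrow> x \<in> Reg_sharp \<and> (\<nexists>f. tau_r_atomic_fact \<tau> x f)" for x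
  let ?step = "\<lambda>x y. pideal x \<subset> pideal y \<and> (\<exists>f. tau_r_fact \<tau> x f \<and> y \<in> set (snd f))"
  assume "\<not> tau_r_atomic \<tau>"
  then have "\<exists>x. Bad x" by (auto simp: Bad_def tau_r_atomic_def)
  moreover have "\<exists>y. Bad y \<and> ?step x y" if "Bad x" for x
    using that nonatomic_proper_factor[OF assms(1)] unfolding Bad_def by metis
  ultimately obtain a where "\<And>n. Bad (a n)" "\<And>n. ?step (a n) (a (Suc n))"
    using dependent_nat_choice[of "\<lambda>_. Bad" "\<lambda>_. ?step"] by metis
  then have "\<forall>n. a n \<in> Reg \<and> ?step (a n) (a (Suc n))"
    by (auto simp: Bad_def Reg_sharp_def)
  with assms(2) show False unfolding tau_r_ACCP_def by blast
qed

section \<open>The implications between the factorization properties\<close>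

theorem theorem3p3:
  fixes \<tau> :: "('a::comm_ring_1 \<times> 'a) set"
  assumes "\<tau> \<subseteq> sharp \<times> sharp" and "sym \<tau>"
  shows "(tau_r_UFR \<tau> \<longrightarrow> tau_r_HFR \<tau>) \<and>
    (refinable \<tau> \<and> tau_r_HFR \<tau> \<longrightarrow> tau_r_BFR \<tau>) \<and>
    (refinable \<tau> \<and> tau_r_UFR \<tau> \<longrightarrow> tau_r_FFR \<tau>) \<and>
    (tau_r_FFR \<tau> \<longrightarrow> tau_r_BFR \<tau>) \<and>
    (refinable \<tau> \<and> tau_r_BFR \<tau> \<longrightarrow> tau_r_ACCP \<tau>) \<and>
    (refinable \<tau> \<and> tau_r_ACCP \<tau> \<longrightarrow> tau_r_atomic \<tau>)"
  using refinable_HFR_imp_BFR refinable_UFR_imp_FFR FFR_imp_BFR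
    refinable_BFR_imp_ACCP refinable_ACCP_imp_atomic
  unfolding tau_r_UFR_def by blast

end
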